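(* There is an absolute constant $C>0$ such that the following holds. Let $p$ be a prime, let $g$ be a primitive root modulo $p$, let $N$ be an integer with $1\le N<p$, and let $h$ be an integer with $h\not\equiv 0\pmod p$. Let $J_1$ denote the number of pairs of integers $(x,y)$ satisfying $$g^x-g^y\equiv h\pmod p,\qquad 1\le x,y\le N.$$ Then $$\left|J_1-\frac{N^2}{p}\right|\le C\left(\frac{N}{p^{1/4}}+p^{1/2}\right).$$ *)

theory Defs
  imports Complex_Main "HOL-Number_Theory.Number_Theory"
begin

text \<open>
  An integer \<open>g\<close> is a primitive root modulo \<open>p\<close>. The library predicate
  \<^const>\<open>residue_primroot\<close> takes a natural number and depends only on its residue
  class, so it is applied to the least non-negative residue of \<open>g\<close>.
\<close>
definition primitive_root_mod :: "nat \<Rightarrow> int \<Rightarrow> bool" where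
  "primitive_root_mod p g \<longleftrightarrow> residue_primroot p (nat (g mod int p))"

definition J1 :: "nat \<Rightarrow> int \<Rightarrow> nat \<Rightarrow> int \<Rightarrow> nat" where
  "J1 p g N h =
     card {(x :: nat, y :: nat).
             x \<in> {1..N} \<and> y \<in> {1..N} \<and> [g ^ x - g ^ y = h] (mod int p)}"

end

theory Submission
  imports Defs "HOL-Analysis.Convex"
begin

text \<open>
  The logarithms of the usual completion argument are avoided by averaging over shifts of the
  exponents. Replace \<open>(x, y)\<close> by \<open>(u + v, w + z)\<close> with \<open>v, z \<le> M\<close>: the equation
  \<open>g\<^sup>u g\<^sup>v - g\<^sup>w g\<^sup>z = h\<close> says that the point \<open>(g\<^sup>u, g\<^sup>w)\<close> lies on the line with
  coefficients \<open>(g\<^sup>v, g\<^sup>z)\<close>. Two distinct points lie on at most one common line of this kind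
  (here \<open>h \<noteq> 0\<close> matters), so a second moment computation over all \<open>p\<^sup>2\<close> lines shows that
  \<open>K\<^sup>2\<close> points and \<open>M\<^sup>2\<close> lines have \<open>K\<^sup>2 M\<^sup>2 / p + O(p\<^sup>1\<^sup>/\<^sup>2 K M)\<close> incidences. Enlarging or
  shrinking the range of \<open>u, w\<close> by \<open>M\<close> bounds \<open>J1\<close> from above or below, with total error
  \<open>O(N M / p + p\<^sup>1\<^sup>/\<^sup>2 N / M)\<close>; the choice \<open>M = min N p\<^sup>3\<^sup>/\<^sup>4\<close> is optimal.
\<close>

section \<open>Incidences between points and lines modulo a prime\<close>

text \<open>The pair \<open>(a, c)\<close> is a point and \<open>l\<close> runs over the lines, so
  this counts the lines through one point. Since \<open>a\<close> is invertible, the second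
  coefficient \<open>d\<close> is free and determines the first.\<close>

lemma card_line_mod_prime:
  fixes a c h :: int
  assumes p: "prime p" and a: "\<not> [a = 0] (mod int p)"
  shows "card {l \<in> {0..<int p} \<times> {0..<int p}. [a * fst l - c * snd l = h] (mod int p)} = p"
    (is "card ?L = p")
proof -
  have p0: "int p > 0" using p prime_gt_0_nat by simp
  have "coprime a (int p)"
    using p a by (metis cong_0_iff coprime_commute prime_imp_coprime prime_nat_int_transfer)
  then obtain a' where a': "[a * a' = 1] (mod int p)"
    using cong_solve_coprime_int by blast
  let ?f = "\<lambda>d. ((a' * (h + c * d)) mod int p, d)"
  have "?L = ?f ` {0..<int p}"
  proof (intro equalityI subsetI)
    fix l assume l: "l \<in> ?L"
    obtain b d where bd: "l = (b, d)" by force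
    have c1: "[a * b - c * d = h] (mod int p)" using l bd by simp
    have c2: "[a' * (a * b - c * d + c * d) = a' * (h + c * d)] (mod int p)"
      using c1 by (intro cong_mult cong_add) auto
    have "[a * a' * b = 1 * b] (mod int p)" using a' by (rule cong_scalar_right)
    then have "[b = a' * (h + c * d)] (mod int p)"
      using c2 by (auto simp: algebra_simps intro: cong_trans cong_sym)
    moreover have "b mod int p = b" using l bd by simp
    ultimately have "b = (a' * (h + c * d)) mod int p" by (simp add: cong_def)
    then show "l \<in> ?f ` {0..<int p}" using l bd by auto
  next
    fix l assume "l \<in> ?f ` {0..<int p}"
    then obtain d where d: "d \<in> {0..<int p}" "l = ?f d" by blast
    have "[a * ((a' * (h + c * d)) mod int p) = a * (a' * (h + c * d))] (mod int p)"
      by (intro cong_mult) auto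
    also have "[a * (a' * (h + c * d)) = 1 * (h + c * d)] (mod int p)"
      using cong_scalar_right[OF a', of "h + c * d"] by (simp add: mult.assoc)
    finally have "[a * ((a' * (h + c * d)) mod int p) - c * d = 1 * (h + c * d) - c * d] (mod int p)"
      by (intro cong_diff) auto
    then show "l \<in> ?L" using d p0 by auto
  qed
  moreover have "inj_on ?f {0..<int p}" by (auto intro: inj_onI)
  ultimately show ?thesis by (simp add: card_image)
qed

lemma cong_mult_lcancel_prime:
  fixes a b c :: int
  assumes "prime p" "\<not> [c = 0] (mod int p)" "[c * a = c * b] (mod int p)"
  shows "[a = b] (mod int p)"
proof -
  have "coprime c (int p)"
    using assms by (metis cong_0_iff coprime_commute prime_imp_coprime prime_nat_int_transfer)
  then show ?thesis using assms(3) cong_mult_lcancel by blast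
qed

text \<open>Two lines \<open>l\<close>, \<open>m\<close> through both points solve the same 2 x 2
  linear system, so it suffices that its determinant is nonzero. If it vanished, elimination would
  give \<open>h * a = h * a'\<close>; cancelling \<open>h\<close> and then \<open>a\<close> would
  make the two points equal.\<close>

lemma card_two_lines_mod_prime_le:
  fixes a c a' c' h :: int
  assumes p: "prime p" and h: "\<not> [h = 0] (mod int p)" and a: "\<not> [a = 0] (mod int p)"
    and ne: "\<not> ([a = a'] (mod int p) \<and> [c = c'] (mod int p))"
  shows "card {l \<in> {0..<int p} \<times> {0..<int p}. [a * fst l - c * snd l = h] (mod int p)
           \<and> [a' * fst l - c' * snd l = h] (mod int p)} \<le> 1"
    (is "card ?L \<le> 1")
proof -
  have "l = m" if l: "l \<in> ?L" and m: "m \<in> ?L" for l m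
  proof -
    obtain b d where bd: "l = (b, d)" by force
    obtain e f where ef: "m = (e, f)" by force
    have l1: "int p dvd a * b - c * d - h" and l2: "int p dvd a' * b - c' * d - h"
      using l bd by (auto simp: cong_iff_dvd_diff)
    have m1: "int p dvd a * e - c * f - h" and m2: "int p dvd a' * e - c' * f - h"
      using m ef by (auto simp: cong_iff_dvd_diff)
    have det: "\<not> [a * c' - a' * c = 0] (mod int p)"
    proof
      assume "[a * c' - a' * c = 0] (mod int p)"
      then have D: "int p dvd a * c' - a' * c" by (simp add: cong_0_iff)
      \<comment> \<open>Eliminating \<open>b\<close> between the two equations of \<open>l\<close>
        leaves only the constants \<open>h\<close>, because the coefficient of \<open>d\<close> is
        the determinant.\<close>
      have "int p dvd a' * (a * b - c * d - h) - a * (a' * b - c' * d - h) - (a * c' - a' * c) * d"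
          by (rule dvd_diff[OF dvd_diff[OF dvd_mult[OF l1] dvd_mult[OF l2]] dvd_mult2[OF D]])
      also have "\<dots> = h * a - h * a'" by (simp add: algebra_simps)
      finally have aa: "[a = a'] (mod int p)"
        unfolding cong_iff_dvd_diff[symmetric] by (rule cong_mult_lcancel_prime[OF p h])
      have "int p dvd a' * c - a * c' + (a - a') * c"
        using D aa by (intro dvd_add[OF _ dvd_mult2])
          (auto simp: cong_iff_dvd_diff dvd_diff_commute)
      also have "\<dots> = a * c - a * c'" by (simp add: algebra_simps)
      finally have "[c = c'] (mod int p)"
        unfolding cong_iff_dvd_diff[symmetric] by (rule cong_mult_lcancel_prime[OF p a])
      with aa ne show False by blast
    qed
    \<comment> \<open>The same elimination for \<open>l\<close> and for \<open>m\<close>,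
      subtracted: now the constants cancel and the determinant times \<open>d - f\<close>
      remains.\<close>
    have "int p dvd a' * (a * b - c * d - h) - a * (a' * b - c' * d - h)
        - (a' * (a * e - c * f - h) - a * (a' * e - c' * f - h))"
      by (rule dvd_diff[OF dvd_diff[OF dvd_mult[OF l1] dvd_mult[OF l2]]
            dvd_diff[OF dvd_mult[OF m1] dvd_mult[OF m2]]])
    also have "\<dots> = (a * c' - a' * c) * d - (a * c' - a' * c) * f" by (simp add: algebra_simps)
    finally have d: "[d = f] (mod int p)"
        unfolding cong_iff_dvd_diff[symmetric] by (rule cong_mult_lcancel_prime[OF p det])
    have "int p dvd (a * b - c * d - h) - (a * e - c * f - h) + c * (d - f)"
      using d by (intro dvd_add[OF dvd_diff[OF l1 m1] dvd_mult]) (simp add: cong_iff_dvd_diff)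
    also have "\<dots> = a * b - a * e" by (simp add: algebra_simps)
    finally have b: "[b = e] (mod int p)"
        unfolding cong_iff_dvd_diff[symmetric] by (rule cong_mult_lcancel_prime[OF p a])
    show ?thesis using b d l m bd ef by (auto simp: cong_def)
  qed
  moreover have "finite ?L" by simp
  ultimately show ?thesis unfolding One_nat_def by (subst card_le_Suc0_iff_eq) blast+
qed

text \<open>Expand the square. Each point lies on \<open>p\<close> of the \<open>p^2\<close> lines,
  so the mean is \<open>card S / p\<close>. In the second moment the diagonal pairs give
  \<open>p\<close> each and the other pairs at most 1; the resulting \<open>(card S)^2\<close>
  cancels against the mean, leaving \<open>p * card S\<close>.\<close>

lemma point_line_variance_le:
  fixes \<alpha> \<gamma> :: "'i \<Rightarrow> int" and S :: "'i set" and h :: int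
  assumes p: "prime p" and h: "\<not> [h = 0] (mod int p)" and S: "finite S"
    and a: "\<And>i. i \<in> S \<Longrightarrow> \<not> [\<alpha> i = 0] (mod int p)"
    and inj: "\<And>i j. \<lbrakk>i \<in> S; j \<in> S; [\<alpha> i = \<alpha> j] (mod int p); [\<gamma> i = \<gamma> j] (mod int p)\<rbrakk> \<Longrightarrow> i = j"
  shows "(\<Sum>l \<in> {0..<int p} \<times> {0..<int p}.
      (real (card {i \<in> S. [\<alpha> i * fst l - \<gamma> i * snd l = h] (mod int p)}) - card S / p)\<^sup>2)
    \<le> real p * card S"
proof -
  define R where "R = {0..<int p} \<times> {0..<int p}"
  define e :: "'i \<Rightarrow> int \<times> int \<Rightarrow> real" where
    "e = (\<lambda>i l. of_bool [\<alpha> i * fst l - \<gamma> i * snd l = h] (mod int p))"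
  have finR: "finite R" by (simp add: R_def)
  have cardR: "real (card R) = real p ^ 2" by (simp add: R_def card_cartesian_product power2_eq_square)
  have p0: "real p > 0" using p prime_gt_0_nat by simp
  have I: "real (card {i \<in> S. [\<alpha> i * fst l - \<gamma> i * snd l = h] (mod int p)}) = (\<Sum>i\<in>S. e i l)" for l
    using S by (simp add: e_def Int_def flip: Collect_conj_eq)
  have one: "(\<Sum>l\<in>R. e i l) = p" if "i \<in> S" for i
    using card_line_mod_prime[OF p a[OF that], of "\<gamma> i" h] finR
    by (simp add: e_def R_def Int_def flip: Collect_conj_eq)
  \<comment> \<open>Allowing the extra 1 on the diagonal too makes the double sum exactly
    \<open>p * card S + (card S)^2\<close>.\<close>
  have two: "(\<Sum>l\<in>R. e i l * e j l) \<le> (if i = j then real p else 0) + 1"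
    if "i \<in> S" "j \<in> S" for i j
  proof (cases "i = j")
    case True
    then show ?thesis using one[OF that(1)] by (simp add: e_def flip: of_bool_conj)
  next
    case False
    then have "\<not> ([\<alpha> i = \<alpha> j] (mod int p) \<and> [\<gamma> i = \<gamma> j] (mod int p))" using inj that by blast
    from card_two_lines_mod_prime_le[OF p h a[OF that(1)] this]
    show ?thesis using False finR
      by (simp add: e_def R_def Int_def flip: of_bool_conj Collect_conj_eq)
  qed
  have sum1: "(\<Sum>l\<in>R. \<Sum>i\<in>S. e i l) = p * card S"
    using one by (subst sum.swap) simp
  have "(\<Sum>l\<in>R. (\<Sum>i\<in>S. e i l)\<^sup>2) = (\<Sum>l\<in>R. \<Sum>i\<in>S. \<Sum>j\<in>S. e i l * e j l)"
    by (simp add: power2_eq_square sum_product)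
  also have "\<dots> = (\<Sum>i\<in>S. \<Sum>j\<in>S. \<Sum>l\<in>R. e i l * e j l)"
    by (subst sum.swap, rule sum.cong[OF refl], rule sum.swap)
  also have "\<dots> \<le> (\<Sum>i\<in>S. \<Sum>j\<in>S. (if i = j then real p else 0) + 1)"
    by (intro sum_mono two)
  also have "\<dots> = p * card S + real (card S) ^ 2"
    using S by (simp add: sum.distrib power2_eq_square algebra_simps)
  finally have sum2: "(\<Sum>l\<in>R. (\<Sum>i\<in>S. e i l)\<^sup>2) \<le> p * card S + real (card S) ^ 2" .
  have expand: "(\<Sum>l\<in>R. (F l - c)\<^sup>2)
      = (\<Sum>l\<in>R. (F l)\<^sup>2) - 2 * c * (\<Sum>l\<in>R. F l) + card R * c\<^sup>2" for F and c :: real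
  proof -
    have "(F l - c)\<^sup>2 = (F l)\<^sup>2 - 2 * c * F l + c\<^sup>2" for l
      by (simp add: power2_diff)
    then show ?thesis
      by (simp add: sum.distrib sum_subtractf flip: sum_distrib_left)
  qed
  have "(\<Sum>l\<in>R. ((\<Sum>i\<in>S. e i l) - card S / p)\<^sup>2)
      = (\<Sum>l\<in>R. (\<Sum>i\<in>S. e i l)\<^sup>2) - 2 * (card S / p) * (\<Sum>l\<in>R. \<Sum>i\<in>S. e i l)
        + card R * (card S / p)\<^sup>2"
    by (rule expand)
  also have "\<dots> \<le> p * card S"
    using sum2 p0 unfolding sum1 cardR by (simp add: power2_eq_square)
  finally show ?thesis unfolding I R_def of_nat_mult .
qed

text \<open>Cauchy-Schwarz over \<open>L\<close>, after which the sum of squares is extended to all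
  lines, where the variance bound applies.\<close>

lemma point_line_mixing:
  fixes \<alpha> \<gamma> :: "'i \<Rightarrow> int" and S :: "'i set" and h :: int
  assumes "prime p" "\<not> [h = 0] (mod int p)" "finite S"
    and "\<And>i. i \<in> S \<Longrightarrow> \<not> [\<alpha> i = 0] (mod int p)"
    and "\<And>i j. \<lbrakk>i \<in> S; j \<in> S; [\<alpha> i = \<alpha> j] (mod int p); [\<gamma> i = \<gamma> j] (mod int p)\<rbrakk> \<Longrightarrow> i = j"
    and L: "L \<subseteq> {0..<int p} \<times> {0..<int p}"
  shows "\<bar>(\<Sum>l\<in>L. real (card {i \<in> S. [\<alpha> i * fst l - \<gamma> i * snd l = h] (mod int p)}))
      - real (card S) * card L / p\<bar> \<le> sqrt (real p * card S * card L)"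
proof -
  define I where "I = (\<lambda>l. real (card {i \<in> S. [\<alpha> i * fst l - \<gamma> i * snd l = h] (mod int p)}) - card S / p)"
  have "(\<Sum>l\<in>L. I l)\<^sup>2 \<le> (\<Sum>l\<in>L. (I l)\<^sup>2) * card L"
    using sum_squared_le_sum_of_squares[of I L] by simp
  also have "(\<Sum>l\<in>L. (I l)\<^sup>2) \<le> (\<Sum>l\<in>{0..<int p} \<times> {0..<int p}. (I l)\<^sup>2)"
    using L by (intro sum_mono2) auto
  also have "\<dots> \<le> real p * card S"
    unfolding I_def by (rule point_line_variance_le) (use assms in auto)
  finally have "\<bar>\<Sum>l\<in>L. I l\<bar> \<le> sqrt (real p * card S * card L)"
    by (intro real_le_rsqrt) (simp add: mult_right_mono)
  then show ?thesis by (simp add: I_def sum_subtractf mult.commute)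
qed

section \<open>Powers of a primitive root\<close>

lemma primitive_root_mod_power_cong_iff:
  assumes p: "prime p" and g: "primitive_root_mod p g"
  shows "[g ^ x = g ^ y] (mod int p) \<longleftrightarrow> [x = y] (mod (p - 1))"
proof -
  define k where "k = nat (g mod int p)"
  have k: "residue_primroot p k" using g by (simp add: primitive_root_mod_def k_def)
  have gk: "[g = int k] (mod int p)" using p prime_gt_0_nat by (simp add: k_def cong_def)
  have "[g ^ x = g ^ y] (mod int p) \<longleftrightarrow> [int k ^ x = int k ^ y] (mod int p)"
    using cong_pow[OF gk] by (metis cong_sym cong_trans)
  also have "\<dots> \<longleftrightarrow> [k ^ x = k ^ y] (mod p)"
    by (metis cong_int_iff of_nat_power)
  also have "\<dots> \<longleftrightarrow> [x = y] (mod (p - 1))"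
    using k p order_divides_expdiff[of p k x y] by (auto simp: residue_primroot_def totient_prime)
  finally show ?thesis .
qed

text \<open>Exponents in a window of length \<open>p - 1\<close> differ by less than the period. The
  start \<open>k\<close> is left free because the windows used below start at different
  places.\<close>

lemma primitive_root_mod_power_inj:
  assumes p: "prime p" and g: "primitive_root_mod p g"
    and "[g ^ x = g ^ y] (mod int p)" "x \<in> {k..<k + (p - 1)}" "y \<in> {k..<k + (p - 1)}"
  shows "x = y"
proof -
  have "[x = y] (mod (p - 1))" using assms primitive_root_mod_power_cong_iff by blast
  then have "int (p - 1) dvd int x - int y" by (metis cong_iff_dvd_diff cong_int_iff)
  moreover have "\<bar>int x - int y\<bar> < int (p - 1)" using assms by auto
  ultimately have "int x - int y = 0" using dvd_imp_le_int[of "int x - int y" "int (p - 1)"]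
    by linarith
  then show ?thesis by simp
qed

lemma primitive_root_mod_power_not_zero:
  assumes p: "prime p" and g: "primitive_root_mod p g"
  shows "\<not> [g ^ x = 0] (mod int p)"
proof
  assume "[g ^ x = 0] (mod int p)"
  then have "int p dvd g" 
    by (metis p cong_0_iff prime_dvd_power prime_nat_int_transfer)
  then have "residue_primroot p 0" using g by (simp add: primitive_root_mod_def)
  then show False using p by (auto simp: residue_primroot_def)
qed

section \<open>Incidence counts for windows of exponents\<close>

text \<open>For fixed shifts \<open>v\<close>, \<open>z\<close> these are the exponent pairs of the
  points on the line with coefficients \<open>(g^v, g^z)\<close>.\<close>

definition shifted_solutions where
  "shifted_solutions p g h U v z =
    {i \<in> U \<times> U. [g ^ (fst i + v) - g ^ (snd i + z) = h] (mod int p)}"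

text \<open>The bounds on \<open>K\<close> and \<open>M\<close> keep both windows within one period,
  so there really are \<open>K^2\<close> distinct points and \<open>M^2\<close> distinct lines to
  feed into \<open>point_line_mixing\<close>.\<close>

lemma shifted_solutions_mixing:
  assumes p: "prime p" and g: "primitive_root_mod p g" and h: "\<not> [h = 0] (mod int p)"
    and K: "K \<le> p - 1" and M: "M \<le> p - 1"
  shows "\<bar>(\<Sum>l \<in> {1..M} \<times> {1..M}. real (card (shifted_solutions p g h {k..<k + K} (fst l) (snd l))))
     - (real K)\<^sup>2 * (real M)\<^sup>2 / p\<bar> \<le> sqrt p * K * M"
proof -
  \<comment> \<open>Lines are represented by reduced coefficients, whereas points may stay
    unreduced.\<close>
  define \<pi> where "\<pi> = (\<lambda>l. (g ^ fst l mod int p, g ^ snd l mod int p))"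
  define \<alpha> where "\<alpha> = (\<lambda>i::nat\<times>nat. g ^ fst i)"
  define \<gamma> where "\<gamma> = (\<lambda>i::nat\<times>nat. g ^ snd i)"
  define S where "S = {k..<k + K} \<times> {k..<k + K}"
  have p0: "int p > 0" using p prime_gt_0_nat by simp
  have inj: "inj_on \<pi> ({1..M} \<times> {1..M})"
  proof (rule inj_onI)
    fix l m assume A: "l \<in> {1..M} \<times> {1..M}" "m \<in> {1..M} \<times> {1..M}" "\<pi> l = \<pi> m"
    show "l = m"
      using A M primitive_root_mod_power_inj[OF p g, of "fst l" "fst m" 1]
        primitive_root_mod_power_inj[OF p g, of "snd l" "snd m" 1]
      by (auto simp: \<pi>_def cong_def prod_eq_iff)
  qed
  have cL: "card (\<pi> ` ({1..M} \<times> {1..M})) = M\<^sup>2"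
    using inj by (simp add: card_image card_cartesian_product power2_eq_square)
  have cS: "card S = K\<^sup>2" by (simp add: S_def card_cartesian_product power2_eq_square)
  have eq: "[\<alpha> i * fst (\<pi> l) - \<gamma> i * snd (\<pi> l) = h] (mod int p) \<longleftrightarrow>
      [g ^ (fst i + fst l) - g ^ (snd i + snd l) = h] (mod int p)" for i l
  proof -
    have "[\<alpha> i * fst (\<pi> l) - \<gamma> i * snd (\<pi> l)
        = g ^ (fst i + fst l) - g ^ (snd i + snd l)] (mod int p)"
      unfolding \<alpha>_def \<gamma>_def \<pi>_def power_add by (intro cong_diff cong_mult) auto
    then show ?thesis by (meson cong_sym cong_trans)
  qed
  have "\<bar>(\<Sum>l\<in>\<pi> ` ({1..M} \<times> {1..M}). real (card {i \<in> S. [\<alpha> i * fst l - \<gamma> i * snd l = h] (mod int p)}))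
      - real (card S) * card (\<pi> ` ({1..M} \<times> {1..M})) / p\<bar>
      \<le> sqrt (real p * card S * card (\<pi> ` ({1..M} \<times> {1..M})))"
  proof (rule point_line_mixing[OF p h])
    show "finite S" by (simp add: S_def)
    show "\<not> [\<alpha> i = 0] (mod int p)" for i
      using primitive_root_mod_power_not_zero[OF p g] by (simp add: \<alpha>_def)
    show "i = j" if "i \<in> S" "j \<in> S" "[\<alpha> i = \<alpha> j] (mod int p)" "[\<gamma> i = \<gamma> j] (mod int p)" for i j
      using that K primitive_root_mod_power_inj[OF p g, of "fst i" "fst j" k]
        primitive_root_mod_power_inj[OF p g, of "snd i" "snd j" k]
      by (auto simp: S_def \<alpha>_def \<gamma>_def prod_eq_iff)
    show "\<pi> ` ({1..M} \<times> {1..M}) \<subseteq> {0..<int p} \<times> {0..<int p}"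
      using p0 by (auto simp: \<pi>_def)
  qed
  then show ?thesis
    unfolding cL cS sum.reindex[OF inj]
    by (simp add: eq shifted_solutions_def S_def real_sqrt_mult)
qed

section \<open>Bounds for \<open>J1\<close> by averaging over shifts\<close>

lemma J1_eq: "J1 p g N h = card (shifted_solutions p g h {1..N} 0 0)"
  unfolding J1_def shifted_solutions_def by (rule arg_cong[where f = card]) auto

lemma finite_shifted_solutions: "finite U \<Longrightarrow> finite (shifted_solutions p g h U v z)"
  by (simp add: shifted_solutions_def)

text \<open>The value of \<open>x\<close> determines \<open>g^y\<close>, hence \<open>y\<close>.
  This trivial bound covers the cases where the enlarged window would exceed a period.\<close>

lemma J1_le:
  assumes p: "prime p" and g: "primitive_root_mod p g" and N: "N < p"
  shows "J1 p g N h \<le> N"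
proof -
  let ?A = "shifted_solutions p g h {1..N} 0 0"
  have "inj_on fst ?A"
  proof (rule inj_onI)
    fix i j assume A: "i \<in> ?A" "j \<in> ?A" "fst i = fst j"
    have "[g ^ fst i - (g ^ fst i - g ^ snd i) = g ^ fst j - (g ^ fst j - g ^ snd j)] (mod int p)"
      by (rule cong_diff) (use A in \<open>auto simp: shifted_solutions_def cong_def\<close>)
    then have "[g ^ snd i = g ^ snd j] (mod int p)" by simp
    then have "snd i = snd j"
      using A N by (intro primitive_root_mod_power_inj[OF p g, of _ _ 1])
        (auto simp only: shifted_solutions_def mem_Times_iff mem_Collect_eq atLeastAtMost_iff atLeastLessThan_iff)
    with A show "i = j" by (simp add: prod_eq_iff)
  qed
  moreover have "fst ` ?A \<subseteq> {1..N}" by (auto simp: shifted_solutions_def)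
  ultimately show ?thesis
    unfolding J1_eq by (metis card_atLeastAtMost card_inj_on_le diff_Suc_1 finite_atLeastAtMost)
qed

text \<open>For every shift \<open>(v, z)\<close> each solution \<open>(x, y)\<close> comes from the
  base pair \<open>(x - v, y - z)\<close>, so \<open>J1\<close> is at most each of the
  \<open>M^2\<close> counts over the enlarged window, hence at most their average.\<close>

lemma J1_upper:
  assumes p: "prime p" and g: "primitive_root_mod p g" and h: "\<not> [h = 0] (mod int p)"
    and NM: "N + M \<le> p - 1" and M: "1 \<le> M"
  shows "real (J1 p g N h) \<le> (real (N + M))\<^sup>2 / p + sqrt p * real (N + M) / M"
proof -
  \<comment> \<open>The differences \<open>x - v\<close> lie between \<open>1 - M\<close> and
    \<open>N - 1\<close>; moved up by \<open>p - 1\<close> they fit into the window of length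
    \<open>N + M\<close> from here.\<close>
  define k where "k = p - 1 - M"
  let ?T = "\<lambda>v z. shifted_solutions p g h {k..<k + (N + M)} v z"
  have "J1 p g N h \<le> card (?T (fst l) (snd l))" if l: "l \<in> {1..M} \<times> {1..M}" for l
    unfolding J1_eq
  proof (rule card_inj_on_le)
    \<comment> \<open>adding the period \<open>p - 1\<close> keeps the natural subtraction from truncating\<close>
    let ?f = "\<lambda>i. (p - 1 + fst i - fst l, p - 1 + snd i - snd l)"
    show "inj_on ?f (shifted_solutions p g h {1..N} 0 0)"
      using l NM by (intro inj_onI) (auto simp: prod_eq_iff)
    have per: "[g ^ (p - 1 + x) = g ^ x] (mod int p)" for x
      unfolding primitive_root_mod_power_cong_iff[OF p g] by (simp add: cong_def)
    have "?f i \<in> ?T (fst l) (snd l)" if i: "i \<in> shifted_solutions p g h {1..N} 0 0" for i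
    proof -
      have 1: "[g ^ fst i - g ^ snd i = h] (mod int p)"
        using i by (simp add: shifted_solutions_def)
      have "[g ^ (p - 1 + fst i) - g ^ (p - 1 + snd i) = h] (mod int p)"
        using cong_trans[OF cong_diff[OF per per] 1] .
      moreover have "p - 1 + fst i - fst l + fst l = p - 1 + fst i"
        "p - 1 + snd i - snd l + snd l = p - 1 + snd i"
        using l NM by auto
      ultimately show ?thesis
        using i l NM M by (auto simp: shifted_solutions_def k_def)
    qed
    then show "?f ` shifted_solutions p g h {1..N} 0 0 \<subseteq> ?T (fst l) (snd l)" by blast
    show "finite (?T (fst l) (snd l))" by (simp add: finite_shifted_solutions)
  qed
  then have "(\<Sum>l\<in>{1..M} \<times> {1..M}. real (J1 p g N h))
      \<le> (\<Sum>l\<in>{1..M} \<times> {1..M}. real (card (?T (fst l) (snd l))))"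
    by (intro sum_mono) simp
  also have "\<dots> \<le> (real (N + M))\<^sup>2 * (real M)\<^sup>2 / p + sqrt p * real (N + M) * M"
    using shifted_solutions_mixing[OF p g h NM, of M k] NM by simp
  also have "\<dots> = real M ^ 2 * ((real (N + M))\<^sup>2 / p + sqrt p * real (N + M) / M)"
    using M by (simp add: power2_eq_square distrib_left del: of_nat_add)
  finally have "real M ^ 2 * real (J1 p g N h)
      \<le> real M ^ 2 * ((real (N + M))\<^sup>2 / p + sqrt p * real (N + M) / M)"
    by (simp add: card_cartesian_product power2_eq_square)
  then show ?thesis using M by (subst (asm) mult_le_cancel_left_pos) auto
qed

text \<open>Conversely, base exponents from \<open>0\<close> to \<open>N - M - 1\<close> stay within
  \<open>{1..N}\<close> after adding a shift in \<open>{1..M}\<close>, so every such count is at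
  most \<open>J1\<close>.\<close>

lemma J1_lower:
  assumes p: "prime p" and g: "primitive_root_mod p g" and h: "\<not> [h = 0] (mod int p)"
    and N: "N < p" and MN: "M \<le> N" and M: "1 \<le> M"
  shows "real (J1 p g N h) \<ge> (real (N - M))\<^sup>2 / p - sqrt p * real (N - M) / M"
proof -
  let ?T = "\<lambda>v z. shifted_solutions p g h {0..<0 + (N - M)} v z"
  have "card (?T (fst l) (snd l)) \<le> J1 p g N h" if l: "l \<in> {1..M} \<times> {1..M}" for l
    unfolding J1_eq
  proof (rule card_inj_on_le)
    let ?f = "\<lambda>i. (fst i + fst l, snd i + snd l)"
    show "inj_on ?f (?T (fst l) (snd l))"
      by (intro inj_onI) (auto simp: prod_eq_iff)
    show "?f ` ?T (fst l) (snd l) \<subseteq> shifted_solutions p g h {1..N} 0 0"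
      using l by (auto simp: shifted_solutions_def)
    show "finite (shifted_solutions p g h {1..N} 0 0)" by (simp add: finite_shifted_solutions)
  qed
  then have "(\<Sum>l\<in>{1..M} \<times> {1..M}. real (J1 p g N h))
      \<ge> (\<Sum>l\<in>{1..M} \<times> {1..M}. real (card (?T (fst l) (snd l))))"
    by (intro sum_mono) simp
  moreover have "(\<Sum>l\<in>{1..M} \<times> {1..M}. real (card (?T (fst l) (snd l))))
      \<ge> (real (N - M))\<^sup>2 * (real M)\<^sup>2 / p - sqrt p * real (N - M) * M"
    using shifted_solutions_mixing[OF p g h, of "N - M" M 0] N MN by linarith
  moreover have "(real (N - M))\<^sup>2 * (real M)\<^sup>2 / p - sqrt p * real (N - M) * M
      = real M ^ 2 * ((real (N - M))\<^sup>2 / p - sqrt p * real (N - M) / M)"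
    using M by (simp add: power2_eq_square right_diff_distrib)
  ultimately have "real M ^ 2 * real (J1 p g N h)
      \<ge> real M ^ 2 * ((real (N - M))\<^sup>2 / p - sqrt p * real (N - M) / M)"
    by (simp add: card_cartesian_product power2_eq_square)
  then show ?thesis using M by (subst (asm) mult_le_cancel_left_pos) auto
qed

section \<open>Choice of the shift range and the final estimate\<close>

text \<open>Here \<open>q\<close> is the fourth root of \<open>p\<close>, which turns the fractional
  powers into integer ones: the threshold for \<open>N\<close> and the ideal \<open>M\<close> are
  \<open>q^3\<close>, and \<open>sqrt p\<close> is \<open>q^2\<close>.\<close>

lemma J1_asymptotic:
  fixes q :: real
  assumes p: "prime p" and g: "primitive_root_mod p g" and h: "\<not> [h = 0] (mod int p)"
    and N: "1 \<le> N" "N < p" and q: "q \<ge> 1" and pq: "real p = q ^ 4"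
  shows "\<bar>real (J1 p g N h) - (real N)\<^sup>2 / p\<bar> \<le> 7 * (real N / q + q\<^sup>2)"
proof -
  let ?J = "real (J1 p g N h)"
  have q0: "q > 0" using q by simp
  have sq: "sqrt p = q\<^sup>2" using pq q by (simp add: real_sqrt_unique flip: power_mult)
  define r where "r = real N / q"
  have nn: "0 \<le> r" "0 \<le> q\<^sup>2" using q0 by (auto simp: r_def)
  have JN: "?J \<le> N" using J1_le[OF p g N(2)] by simp
  show ?thesis
  proof (cases "real N \<le> q ^ 3")
    case True
    \<comment> \<open>For small \<open>N\<close> the main term is itself within the error, so an
      upper bound for \<open>J1\<close> suffices; it comes from \<open>M = N\<close>.\<close>
    have N2: "(real N)\<^sup>2 / p \<le> q\<^sup>2"
    proof -
      have "(real N)\<^sup>2 \<le> (q ^ 3)\<^sup>2" using True by (intro power_mono) auto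
      also have "\<dots> = q\<^sup>2 * p" unfolding pq by (simp flip: power_mult power_add)
      finally show ?thesis using q0 pq by (simp add: divide_le_eq)
    qed
    have "?J \<le> 6 * q\<^sup>2"
    proof (cases "N + N \<le> p - 1")
      case True
      have "?J \<le> (real (N + N))\<^sup>2 / p + sqrt p * real (N + N) / N"
        by (rule J1_upper[OF p g h True N(1)])
      also have "\<dots> = 4 * ((real N)\<^sup>2 / p) + 2 * q\<^sup>2"
        using N unfolding sq by (simp add: power2_eq_square)
      finally show ?thesis using N2 by linarith
    next
      case False
      \<comment> \<open>The window is too long only if \<open>p \<le> 2 * N \<le> 2 * q^3\<close>,
        which forces \<open>q \<le> 2\<close>; then \<open>J1 \<le> N \<le> q^3\<close> is already
        at most \<open>2 * q^2\<close>.\<close>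
      then have "q ^ 4 \<le> 2 * N" using pq by linarith
      then have "q ^ 3 * q \<le> q ^ 3 * 2" using True by (simp add: power_numeral_reduce mult_ac)
      then have "q \<le> 2" using q0 by (subst (asm) mult_le_cancel_left_pos) auto
      then have "q\<^sup>2 * q \<le> q\<^sup>2 * 2" by (intro mult_left_mono) auto
      then show ?thesis using JN True nn by (simp add: power_numeral_reduce)
    qed
    moreover have "0 \<le> (real N)\<^sup>2 / p" "0 \<le> ?J" by auto
    ultimately show ?thesis unfolding r_def[symmetric] abs_le_iff distrib_left using N2 nn by linarith
  next
    case False
    define M where "M = nat \<lfloor>q ^ 3\<rfloor>"
    have q3: "q ^ 3 \<ge> 1" using q by simp
    have M_le: "real M \<le> q ^ 3" using q3 unfolding M_def by linarith
    have M1: "1 \<le> M" using q3 unfolding M_def by linarith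
    have M_ge: "2 * real M \<ge> q ^ 3" using M1 unfolding M_def by linarith
    have MN: "M \<le> N" using M_le False by linarith
    \<comment> \<open>Up to sign \<open>2 * t\<close> is the cross term of
      \<open>(N + M)^2 / p\<close> and \<open>(N - M)^2 / p\<close>, and \<open>s\<close> is the
      part of the incidence error proportional to \<open>N\<close>. The choice of \<open>M\<close>
      makes both \<open>O(r)\<close>.\<close>
    define t s where "t = real N * M / p" and "s = sqrt p * N / M"
    have a1: "t \<le> r"
    proof -
      have "t \<le> real N * q ^ 3 / p" unfolding t_def using M_le by (intro divide_right_mono mult_left_mono) auto
      also have "\<dots> = r" using q0 unfolding pq r_def by (simp add: field_simps power_numeral_reduce)
      finally show ?thesis .
    qed
    have a2: "s \<le> 2 * r"
    proof -
      have "s \<le> q\<^sup>2 * N / (q ^ 3 / 2)"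
        unfolding s_def sq using M_ge M1 q0 by (intro divide_left_mono) auto
      also have "\<dots> = 2 * r" unfolding r_def using q0 by (simp add: field_simps power_numeral_reduce)
      finally show ?thesis .
    qed
    have up: "?J - (real N)\<^sup>2 / p \<le> 7 * r"
    proof (cases "N + M \<le> p - 1")
      case True
      have "?J \<le> (real (N + M))\<^sup>2 / p + sqrt p * real (N + M) / M"
        by (rule J1_upper[OF p g h True M1])
      also have "\<dots> = (real N)\<^sup>2 / p + 2 * (t) + real M * M / p + s + q\<^sup>2"
        using M1 unfolding t_def s_def sq by (simp add: power2_eq_square add_divide_distrib algebra_simps)
      finally have "?J \<le> \<dots>" .
      moreover have "real M * M / p \<le> t"
        unfolding t_def using MN by (intro divide_right_mono mult_right_mono) auto
      moreover have "q\<^sup>2 \<le> r"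
        unfolding r_def using False q0 by (simp add: le_divide_eq power_numeral_reduce)
      ultimately show ?thesis using a1 a2 nn by linarith
    next
      case False
      \<comment> \<open>Now \<open>N\<close> is within \<open>M\<close> of \<open>p\<close>, so the
        trivial bound \<open>N\<close> exceeds \<open>N^2 / p\<close> by only
        \<open>N * (p - N) / p \<le> t\<close>.\<close>
      then have "real p - N \<le> M" by linarith
      then have "real N * (real p - N) / p \<le> t"
        unfolding t_def by (intro divide_right_mono mult_left_mono) auto
      moreover have "real N * (real p - N) / p = N - (real N)\<^sup>2 / p"
        using N by (simp add: field_simps power2_eq_square)
      ultimately show ?thesis using a1 JN nn by linarith
    qed
    have "(real N)\<^sup>2 / p - ?J \<le> 7 * r"
    proof -
      have "?J \<ge> (real (N - M))\<^sup>2 / p - sqrt p * real (N - M) / M"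
        by (rule J1_lower[OF p g h N(2) MN M1])
      moreover have "(real (N - M))\<^sup>2 / p = (real N)\<^sup>2 / p - 2 * (t) + real M * M / p"
        unfolding t_def using MN by (simp add: of_nat_diff power2_eq_square add_divide_distrib diff_divide_distrib algebra_simps)
      moreover have "sqrt p * real (N - M) / M \<le> s"
        unfolding s_def by (intro divide_right_mono mult_left_mono) auto
      moreover have "real M * M / p \<ge> 0" by simp
      ultimately show ?thesis using a1 a2 nn by linarith
    qed
    with up nn show ?thesis unfolding r_def[symmetric] abs_le_iff distrib_left by linarith
  qed
qed

theorem theorem2:
  shows "\<exists>C :: real. C > 0 \<and>
    (\<forall>(p :: nat) (g :: int) (N :: nat) (h :: int).
       prime p \<longrightarrow> primitive_root_mod p g \<longrightarrow> 1 \<le> N \<longrightarrow> N < p \<longrightarrow>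
       \<not> [h = 0] (mod int p) \<longrightarrow>
       \<bar>real (J1 p g N h) - (real N)\<^sup>2 / real p\<bar>
         \<le> C * (real N / real p powr (1 / 4) + real p powr (1 / 2)))"
proof (intro exI[of _ 7] conjI allI impI)
  fix p N :: nat and g h :: int
  assume A: "prime p" "primitive_root_mod p g" "1 \<le> N" "N < p" "\<not> [h = 0] (mod int p)"
  have p1: "real p \<ge> 1" using A by linarith
  have "real p = (real p powr (1 / 4)) ^ 4" "(real p powr (1 / 4))\<^sup>2 = real p powr (1 / 2)"
    using p1 by (simp_all add: powr_powr flip: powr_realpow)
  moreover have "real p powr (1 / 4) \<ge> 1" using p1 by (simp add: ge_one_powr_ge_zero)
  ultimately show "\<bar>real (J1 p g N h) - (real N)\<^sup>2 / real p\<bar>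
      \<le> 7 * (real N / real p powr (1 / 4) + real p powr (1 / 2))"
    using J1_asymptotic[OF A(1,2,5,3,4), of "real p powr (1 / 4)"] by simp
qed simp

end
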